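(* Let $\mathcal{G}_j=(B_j,\psi_j,A_j)$, $j=0,1$, be real tracial quantum graphs with quantum relations $\mathcal{S}_j=\mathrm{range}(A_j\bullet\cdot)\subset B(L^2(\mathcal{G}_j))$, and suppose that $\mathcal{G}_1$ is Schur central. Let $f:B_1\to B_0$ be a unital $*$-homomorphism. Then $f^{\mathrm{op}}:\mathcal{G}_0\to\mathcal{G}_1$ is a graph homomorphism if and only if $(f,\mathbb{C}):\mathcal{G}_0\to\mathcal{G}_1$ is a $loc$-homomorphism.
   Context: A quantum set is a pair $(B,\psi)$ where $B$ is a finite-dimensional $C^*$-algebra with multiplication $m:B\otimes B\to B$, and $\psi$ is a faithful state on $B$ that is a $\delta$-form, i.e. $mm^\dagger=\delta^2\,\mathrm{id}_B$ for some $\delta\ge 0$. Here $B$ is regarded as the Hilbert space $L^2(B,\psi)$ with inner product $\langle x|y\rangle=\psi(x^*y)$, $B\otimes B$ carries the inner product from $\psi\otimes\psi$, and $(\cdot)^\dagger$ is the Hilbert space adjoint of operators. For linear maps $S,T:B\to B$, the Schur product is $S\bullet T=\delta^{-2}m(S\otimes T)m^\dagger$ and the involution is $T^*(x)=(T(x^* ))^*$. A quantum graph is a triple $\mathcal{G}=(B,\psi,A)$ with $(B,\psi)$ a quantum set and $A:B\to B$ linear satisfying $A\bullet A=A$; $L^2(\mathcal{G})=L^2(B,\psi)$. It is real if $A^*=A$; tracial if $\psi$ is a trace; Schur central if $A\bullet T=T\bullet A$ for all $T\in B(L^2(B,\psi))$. For a unital $*$-homomorphism $f:B_1\to B_0$,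 let $f^\dagger$ be the adjoint of $f:L^2(\mathcal{G}_1)\to L^2(\mathcal{G}_0)$. $f^{\mathrm{op}}:\mathcal{G}_0\to\mathcal{G}_1$ is a graph homomorphism if $A_1\bullet(f^\dagger A_0f)=f^\dagger A_0f$. $(f,\mathbb{C}):\mathcal{G}_0\to\mathcal{G}_1$ is a $loc$-homomorphism if $f^\dagger\mathcal{S}_0f\subset\mathcal{S}_1$, where $\mathcal{S}_j=\{A_j\bullet T: T\in B(L^2(\mathcal{G}_j))\}$. *)

theory Defs
  imports Complex_Main "HOL-Library.Poly_Mapping" "HOL-Library.Nonpos_Ints"
begin

section \<open>Complex vector spaces and C*-algebras\<close>

class scaleC =
  fixes scaleC :: "complex \<Rightarrow> 'a \<Rightarrow> 'a" (infixr \<open>*\<^sub>C\<close> 75)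

class complex_vector = scaleC + ab_group_add +
  assumes scaleC_add_right: "c *\<^sub>C (x + y) = c *\<^sub>C x + c *\<^sub>C y"
    and scaleC_add_left: "(c + d) *\<^sub>C x = c *\<^sub>C x + d *\<^sub>C x"
    and scaleC_scaleC [simp]: "c *\<^sub>C d *\<^sub>C x = (c * d) *\<^sub>C x"
    and scaleC_one [simp]: "1 *\<^sub>C x = x"

global_interpretation complex_vector: vector_space "scaleC :: complex \<Rightarrow> 'a \<Rightarrow> 'a::complex_vector"
  by standard (simp_all add: scaleC_add_right scaleC_add_left)

instantiation complex :: complex_vector
begin
definition scaleC_complex :: "complex \<Rightarrow> complex \<Rightarrow> complex"
  where "scaleC_complex c z = c * z"
instance by standard (simp_all add: scaleC_complex_def algebra_simps)
end

abbreviation clinear :: "('a::complex_vector \<Rightarrow> 'b::complex_vector) \<Rightarrow> bool"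
  where "clinear \<equiv> Vector_Spaces.linear scaleC scaleC"

class star =
  fixes star :: "'a \<Rightarrow> 'a"

text \<open>A nonzero unital C*-algebra; \<open>norm 1 = 1\<close> is part of \<^class>\<open>real_normed_algebra_1\<close>.
  Finite-dimensional C*-algebras are always unital, and the existence of a state excludes the
  zero algebra, so nothing is lost here.\<close>

class cstar_algebra = real_normed_algebra_1 + banach + complex_vector + star +
  assumes scaleR_eq_scaleC: "r *\<^sub>R x = complex_of_real r *\<^sub>C x"
    and mult_scaleC_left: "(c *\<^sub>C x) * y = c *\<^sub>C (x * y)"
    and mult_scaleC_right: "x * (c *\<^sub>C y) = c *\<^sub>C (x * y)"
    and norm_scaleC: "norm (c *\<^sub>C x) = cmod c * norm x"
    and star_star [simp]: "star (star x) = x"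
    and star_add: "star (x + y) = star x + star y"
    and star_scaleC: "star (c *\<^sub>C x) = cnj c *\<^sub>C star x"
    and star_mult: "star (x * y) = star y * star x"
    and norm_star_mult: "norm (star x * x) = (norm x)\<^sup>2"

definition unital_star_hom :: "('a::cstar_algebra \<Rightarrow> 'b::cstar_algebra) \<Rightarrow> bool"
  where "unital_star_hom f \<longleftrightarrow>
    clinear f \<and> f 1 = 1 \<and> (\<forall>x y. f (x * y) = f x * f y) \<and> (\<forall>x. f (star x) = star (f x))"


section \<open>The tensor product\<close>

text \<open>The tensor product over the complex numbers is the free complex vector space on pairs,
  modulo the span of the bilinearity relators.\<close>

type_synonym ('a, 'b) formal_tensor = "('a \<times> 'b) \<Rightarrow>\<^sub>0 complex"

definition formal_scale :: "complex \<Rightarrow> ('a, 'b) formal_tensor \<Rightarrow> ('a, 'b) formal_tensor"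
  where "formal_scale c = Poly_Mapping.map ((*) c)"

definition formal_pure :: "'a \<Rightarrow> 'b \<Rightarrow> ('a, 'b) formal_tensor"
  where "formal_pure a b = Poly_Mapping.single (a, b) 1"

lemma lookup_formal_scale [simp]:
  "Poly_Mapping.lookup (formal_scale c u) p = c * Poly_Mapping.lookup u p"
  by (simp add: formal_scale_def Poly_Mapping.map.rep_eq when_def)

global_interpretation formal: vector_space "formal_scale :: complex \<Rightarrow> ('a, 'b) formal_tensor \<Rightarrow> _"
  by standard (simp_all add: poly_mapping_eq_iff fun_eq_iff lookup_add algebra_simps)

inductive_set bilinearity_relators :: "('a::complex_vector, 'b::complex_vector) formal_tensor set"
  where
    add_left: "formal_pure (a + a') b - (formal_pure a b + formal_pure a' b) \<in> bilinearity_relators"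
  | add_right: "formal_pure a (b + b') - (formal_pure a b + formal_pure a b') \<in> bilinearity_relators"
  | scale_left: "formal_pure (c *\<^sub>C a) b - formal_scale c (formal_pure a b) \<in> bilinearity_relators"
  | scale_right: "formal_pure a (c *\<^sub>C b) - formal_scale c (formal_pure a b) \<in> bilinearity_relators"

definition tensor_null :: "('a::complex_vector, 'b::complex_vector) formal_tensor set"
  where "tensor_null = formal.span bilinearity_relators"

lemma tensor_null_0 [simp]: "0 \<in> tensor_null"
  and tensor_null_add: "u \<in> tensor_null \<Longrightarrow> v \<in> tensor_null \<Longrightarrow> u + v \<in> tensor_null"
  and tensor_null_diff: "u \<in> tensor_null \<Longrightarrow> v \<in> tensor_null \<Longrightarrow> u - v \<in> tensor_null"
  and tensor_null_uminus: "u \<in> tensor_null \<Longrightarrow> - u \<in> tensor_null"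
  and tensor_null_scale: "u \<in> tensor_null \<Longrightarrow> formal_scale c u \<in> tensor_null"
  by (simp_all add: tensor_null_def formal.span_zero formal.span_add formal.span_diff
      formal.span_neg formal.span_scale)

quotient_type (overloaded) ('a, 'b) tensor = "('a::complex_vector, 'b::complex_vector) formal_tensor" /
  "\<lambda>u v. u - v \<in> tensor_null"
proof (rule equivpI)
  show "reflp (\<lambda>u v :: ('a, 'b) formal_tensor. u - v \<in> tensor_null)"
    by (simp add: reflp_def)
  show "symp (\<lambda>u v :: ('a, 'b) formal_tensor. u - v \<in> tensor_null)"
    by (rule sympI) (drule tensor_null_uminus, simp)
  show "transp (\<lambda>u v :: ('a, 'b) formal_tensor. u - v \<in> tensor_null)"
    by (rule transpI) (drule (1) tensor_null_add, simp)
qed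

instantiation tensor :: (complex_vector, complex_vector) complex_vector
begin

lift_definition zero_tensor :: "('a, 'b) tensor" is 0 .

lift_definition plus_tensor :: "('a, 'b) tensor \<Rightarrow> ('a, 'b) tensor \<Rightarrow> ('a, 'b) tensor" is "(+)"
  by (drule (1) tensor_null_add) (simp add: algebra_simps)

lift_definition uminus_tensor :: "('a, 'b) tensor \<Rightarrow> ('a, 'b) tensor" is uminus
  by (drule tensor_null_uminus) (simp add: algebra_simps)

lift_definition minus_tensor :: "('a, 'b) tensor \<Rightarrow> ('a, 'b) tensor \<Rightarrow> ('a, 'b) tensor" is "(-)"
  by (drule (1) tensor_null_diff) (simp add: algebra_simps)

lift_definition scaleC_tensor :: "complex \<Rightarrow> ('a, 'b) tensor \<Rightarrow> ('a, 'b) tensor" is formal_scale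
  by (drule tensor_null_scale) (simp add: formal.scale_right_diff_distrib)

instance
  by standard
    (transfer; simp add: algebra_simps formal.scale_right_distrib formal.scale_left_distrib)+

end

lift_definition pure_tensor :: "'a::complex_vector \<Rightarrow> 'b::complex_vector \<Rightarrow> ('a, 'b) tensor"
    (infixr \<open>\<otimes>\<^sub>C\<close> 72) is formal_pure .

lemma pure_tensor_add_left: "(a + a') \<otimes>\<^sub>C b = a \<otimes>\<^sub>C b + a' \<otimes>\<^sub>C b"
  by transfer (unfold tensor_null_def, intro formal.span_base bilinearity_relators.add_left)

lemma pure_tensor_add_right: "a \<otimes>\<^sub>C (b + b') = a \<otimes>\<^sub>C b + a \<otimes>\<^sub>C b'"
  by transfer (unfold tensor_null_def, intro formal.span_base bilinearity_relators.add_right)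

lemma pure_tensor_scaleC_left: "(c *\<^sub>C a) \<otimes>\<^sub>C b = c *\<^sub>C (a \<otimes>\<^sub>C b)"
  by transfer (unfold tensor_null_def, intro formal.span_base bilinearity_relators.scale_left)

lemma pure_tensor_scaleC_right: "a \<otimes>\<^sub>C (c *\<^sub>C b) = c *\<^sub>C (a \<otimes>\<^sub>C b)"
  by transfer (unfold tensor_null_def, intro formal.span_base bilinearity_relators.scale_right)

text \<open>Extension of \<open>\<beta>\<close> from pure tensors, linear for \<open>\<phi> = id\<close> and conjugate-linear for
  \<open>\<phi> = cnj\<close>. It is meaningful when \<open>\<beta>\<close> is biadditive and homogeneous up to \<open>\<phi>\<close>
  in each argument (\<open>semi_bilinear\<close>); then it does not depend on the chosen representative.\<close>

definition formal_extend ::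
    "(complex \<Rightarrow> complex) \<Rightarrow> ('a \<Rightarrow> 'b \<Rightarrow> 'c::complex_vector) \<Rightarrow> ('a, 'b) formal_tensor \<Rightarrow> 'c"
  where "formal_extend \<phi> \<beta> u =
    (\<Sum>p\<in>Poly_Mapping.keys u. \<phi> (Poly_Mapping.lookup u p) *\<^sub>C \<beta> (fst p) (snd p))"

definition tensor_extend ::
    "(complex \<Rightarrow> complex) \<Rightarrow> ('a::complex_vector \<Rightarrow> 'b::complex_vector \<Rightarrow> 'c::complex_vector) \<Rightarrow>
      ('a, 'b) tensor \<Rightarrow> 'c"
  where "tensor_extend \<phi> \<beta> t = formal_extend \<phi> \<beta> (rep_tensor t)"

definition semi_bilinear ::
    "(complex \<Rightarrow> complex) \<Rightarrow> ('a::complex_vector \<Rightarrow> 'b::complex_vector \<Rightarrow> 'c::complex_vector) \<Rightarrow> bool"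
  where "semi_bilinear \<phi> \<beta> \<longleftrightarrow> (\<phi> = id \<or> \<phi> = cnj) \<and>
    (\<forall>a a' b. \<beta> (a + a') b = \<beta> a b + \<beta> a' b) \<and>
    (\<forall>a b b'. \<beta> a (b + b') = \<beta> a b + \<beta> a b') \<and>
    (\<forall>c a b. \<beta> (c *\<^sub>C a) b = \<phi> c *\<^sub>C \<beta> a b) \<and>
    (\<forall>c a b. \<beta> a (c *\<^sub>C b) = \<phi> c *\<^sub>C \<beta> a b)"

context
  fixes \<phi> :: "complex \<Rightarrow> complex"
  assumes \<phi>: "\<phi> = id \<or> \<phi> = cnj"
begin

lemma formal_extend_superset:
  assumes "finite K" "Poly_Mapping.keys u \<subseteq> K"
  shows "formal_extend \<phi> \<beta> u = (\<Sum>p\<in>K. \<phi> (Poly_Mapping.lookup u p) *\<^sub>C \<beta> (fst p) (snd p))"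
  unfolding formal_extend_def
  using assms \<phi> by (intro sum.mono_neutral_left) (auto simp: in_keys_iff)

lemma formal_extend_add:
  "formal_extend \<phi> \<beta> (u + v) = formal_extend \<phi> \<beta> u + formal_extend \<phi> \<beta> v"
proof -
  let ?K = "Poly_Mapping.keys u \<union> Poly_Mapping.keys v"
  have "Poly_Mapping.keys (u + v) \<subseteq> ?K" by (rule keys_add)
  with \<phi> show ?thesis
    by (auto simp: formal_extend_superset[of ?K] lookup_add scaleC_add_left sum.distrib)
qed

lemma formal_extend_scale:
  "formal_extend \<phi> \<beta> (formal_scale c u) = \<phi> c *\<^sub>C formal_extend \<phi> \<beta> u"
proof -
  have "Poly_Mapping.keys (formal_scale c u) \<subseteq> Poly_Mapping.keys u"
    by (auto simp: in_keys_iff)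
  with \<phi> show ?thesis
    by (auto simp: formal_extend_superset[of "Poly_Mapping.keys u"]
        complex_vector.scale_sum_right)
qed

lemma formal_extend_diff:
  "formal_extend \<phi> \<beta> (u - v) = formal_extend \<phi> \<beta> u - formal_extend \<phi> \<beta> v"
  using formal_extend_add[of \<beta> "u - v" v] by (simp add: eq_diff_eq)

lemma formal_extend_pure: "formal_extend \<phi> \<beta> (formal_pure a b) = \<beta> a b"
  using \<phi> by (auto simp: formal_extend_def formal_pure_def)

lemma formal_extend_null:
  assumes "semi_bilinear \<phi> \<beta>" "u \<in> tensor_null"
  shows "formal_extend \<phi> \<beta> u = 0"
  using assms(2) unfolding tensor_null_def
proof (induction rule: formal.span_induct_alt)
  case base
  show ?case by (simp add: formal_extend_def)
next
  case (step c x y)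
  have \<beta>: "\<beta> (a + a') b = \<beta> a b + \<beta> a' b" "\<beta> a (b + b') = \<beta> a b + \<beta> a b'"
    "\<beta> (c *\<^sub>C a) b = \<phi> c *\<^sub>C \<beta> a b" "\<beta> a (c *\<^sub>C b) = \<phi> c *\<^sub>C \<beta> a b" for a a' b b' c
    using assms(1) by (simp_all add: semi_bilinear_def)
  from step(1) have "formal_extend \<phi> \<beta> x = 0"
    by cases (simp_all add: \<beta> formal_extend_diff formal_extend_add formal_extend_scale formal_extend_pure)
  with step show ?case
    by (simp add: formal_extend_add formal_extend_scale)
qed

end

lemma tensor_extend_abs:
  assumes "semi_bilinear \<phi> \<beta>"
  shows "tensor_extend \<phi> \<beta> (abs_tensor u) = formal_extend \<phi> \<beta> u"
proof -
  have \<phi>: "\<phi> = id \<or> \<phi> = cnj" using assms by (simp add: semi_bilinear_def)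
  have "rep_tensor (abs_tensor u) - u \<in> tensor_null"
    by (rule Quotient_rep_abs[OF Quotient_tensor]) simp
  then have "formal_extend \<phi> \<beta> (rep_tensor (abs_tensor u) - u) = 0"
    using formal_extend_null \<phi> assms by blast
  then show ?thesis
    by (simp add: tensor_extend_def formal_extend_diff[OF \<phi>])
qed

lemma tensor_extend_pure:
  assumes "semi_bilinear \<phi> \<beta>"
  shows "tensor_extend \<phi> \<beta> (a \<otimes>\<^sub>C b) = \<beta> a b"
  using assms unfolding pure_tensor.abs_eq tensor_extend_abs[OF assms]
  by (intro formal_extend_pure) (simp add: semi_bilinear_def)

lemma tensor_extend_add:
  assumes "semi_bilinear \<phi> \<beta>"
  shows "tensor_extend \<phi> \<beta> (s + t) = tensor_extend \<phi> \<beta> s + tensor_extend \<phi> \<beta> t"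
proof (induction s, induction t)
  fix u v
  show "tensor_extend \<phi> \<beta> (abs_tensor v + abs_tensor u) =
      tensor_extend \<phi> \<beta> (abs_tensor v) + tensor_extend \<phi> \<beta> (abs_tensor u)"
    using assms unfolding plus_tensor.abs_eq tensor_extend_abs[OF assms]
    by (intro formal_extend_add) (simp add: semi_bilinear_def)
qed

lemma tensor_extend_scaleC:
  assumes "semi_bilinear \<phi> \<beta>"
  shows "tensor_extend \<phi> \<beta> (c *\<^sub>C t) = \<phi> c *\<^sub>C tensor_extend \<phi> \<beta> t"
proof (induction t)
  fix u
  show "tensor_extend \<phi> \<beta> (c *\<^sub>C abs_tensor u) = \<phi> c *\<^sub>C tensor_extend \<phi> \<beta> (abs_tensor u)"
    using assms unfolding scaleC_tensor.abs_eq tensor_extend_abs[OF assms]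
    by (intro formal_extend_scale) (simp add: semi_bilinear_def)
qed

definition tensor_map ::
    "('a::complex_vector \<Rightarrow> 'c::complex_vector) \<Rightarrow> ('b::complex_vector \<Rightarrow> 'd::complex_vector) \<Rightarrow>
      ('a, 'b) tensor \<Rightarrow> ('c, 'd) tensor"
  where "tensor_map S T = tensor_extend id (\<lambda>a b. S a \<otimes>\<^sub>C T b)"

definition tensor_functional ::
    "('a::complex_vector \<Rightarrow> complex) \<Rightarrow> ('b::complex_vector \<Rightarrow> complex) \<Rightarrow> ('a, 'b) tensor \<Rightarrow> complex"
  where "tensor_functional \<psi> \<chi> = tensor_extend id (\<lambda>a b. \<psi> a * \<chi> b)"

definition tensor_times ::
    "('a::cstar_algebra, 'b::cstar_algebra) tensor \<Rightarrow> ('a, 'b) tensor \<Rightarrow> ('a, 'b) tensor"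
  where "tensor_times s t =
    tensor_extend id (\<lambda>a b. tensor_extend id (\<lambda>c d. (a * c) \<otimes>\<^sub>C (b * d)) t) s"

definition tensor_star :: "('a::cstar_algebra, 'b::cstar_algebra) tensor \<Rightarrow> ('a, 'b) tensor"
  where "tensor_star = tensor_extend cnj (\<lambda>a b. star a \<otimes>\<^sub>C star b)"

definition mult_map :: "('a::cstar_algebra, 'a) tensor \<Rightarrow> 'a"
  where "mult_map = tensor_extend id (*)"


section \<open>Hilbert space structure\<close>

definition inner_state :: "('a::cstar_algebra \<Rightarrow> complex) \<Rightarrow> 'a \<Rightarrow> 'a \<Rightarrow> complex"
  where "inner_state \<psi> x y = \<psi> (star x * y)"

definition inner_tensor ::
    "('a::cstar_algebra \<Rightarrow> complex) \<Rightarrow> ('a, 'a) tensor \<Rightarrow> ('a, 'a) tensor \<Rightarrow> complex"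
  where "inner_tensor \<psi> s t = tensor_functional \<psi> \<psi> (tensor_times (tensor_star s) t)"

definition hilbert_adjoint ::
    "('v \<Rightarrow> 'v \<Rightarrow> complex) \<Rightarrow> ('w \<Rightarrow> 'w \<Rightarrow> complex) \<Rightarrow> ('v \<Rightarrow> 'w) \<Rightarrow> 'w \<Rightarrow> 'v"
  where "hilbert_adjoint ipv ipw F = (THE G. \<forall>v w. ipw (F v) w = ipv v (G w))"

lemma mult_map_pure: "mult_map (a \<otimes>\<^sub>C b) = a * b"
  unfolding mult_map_def
  by (subst tensor_extend_pure)
    (simp_all add: semi_bilinear_def algebra_simps mult_scaleC_left mult_scaleC_right)

lemma tensor_map_pure: "clinear S \<Longrightarrow> clinear T \<Longrightarrow> tensor_map S T (a \<otimes>\<^sub>C b) = S a \<otimes>\<^sub>C T b"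
  unfolding tensor_map_def
  by (subst tensor_extend_pure)
    (simp_all add: semi_bilinear_def pure_tensor_add_left pure_tensor_add_right
      pure_tensor_scaleC_left pure_tensor_scaleC_right
      Vector_Spaces.linear_iff)

lemma inner_tensor_pure:
  assumes "clinear \<psi>"
  shows "inner_tensor \<psi> (a \<otimes>\<^sub>C b) (c \<otimes>\<^sub>C d) = inner_state \<psi> a c * inner_state \<psi> b d"
proof -
  note pt = pure_tensor_add_left pure_tensor_add_right
    pure_tensor_scaleC_left pure_tensor_scaleC_right
  have 1: "semi_bilinear cnj (\<lambda>(a::'a) (b::'a). star a \<otimes>\<^sub>C star b)"
    by (simp add: semi_bilinear_def pt star_add star_scaleC)
  have 2: "semi_bilinear id (\<lambda>(c::'a) (d::'a). (a * c) \<otimes>\<^sub>C (b * d))" for a b :: 'a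
    by (simp add: semi_bilinear_def pt distrib_left mult_scaleC_right)
  have 3: "semi_bilinear id (\<lambda>(a::'a) (b::'a). (a * c) \<otimes>\<^sub>C (b * d))"
    by (simp add: semi_bilinear_def pt distrib_right mult_scaleC_left)
  have 4: "semi_bilinear id (\<lambda>a b. \<psi> a * \<psi> b)"
    using assms by (simp add: semi_bilinear_def Vector_Spaces.linear_iff
        scaleC_complex_def algebra_simps)
  show ?thesis
    by (simp add: inner_tensor_def inner_state_def tensor_star_def tensor_times_def
        tensor_functional_def tensor_extend_pure[OF 1] tensor_extend_pure[OF 2]
        tensor_extend_pure[OF 3] tensor_extend_pure[OF 4])
qed


section \<open>Quantum sets and quantum graphs\<close>

definition faithful_state :: "('a::cstar_algebra \<Rightarrow> complex) \<Rightarrow> bool"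
  where "faithful_state \<psi> \<longleftrightarrow> clinear \<psi> \<and> \<psi> 1 = 1 \<and>
    (\<forall>x. \<psi> (star x * x) \<in> \<real>\<^sub>\<ge>\<^sub>0) \<and> (\<forall>x. \<psi> (star x * x) = 0 \<longrightarrow> x = 0)"

definition mult_adjoint :: "('a::cstar_algebra \<Rightarrow> complex) \<Rightarrow> 'a \<Rightarrow> ('a, 'a) tensor"
  where "mult_adjoint \<psi> = hilbert_adjoint (inner_tensor \<psi>) (inner_state \<psi>) mult_map"

definition delta_form :: "('a::cstar_algebra \<Rightarrow> complex) \<Rightarrow> real \<Rightarrow> bool"
  where "delta_form \<psi> \<delta> \<longleftrightarrow> 0 \<le> \<delta> \<and>
    (\<forall>x. mult_map (mult_adjoint \<psi> x) = complex_of_real (\<delta>\<^sup>2) *\<^sub>C x)"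

definition quantum_set :: "('a::cstar_algebra \<Rightarrow> complex) \<Rightarrow> bool"
  where "quantum_set \<psi> \<longleftrightarrow>
    (\<exists>S :: 'a set. finite S \<and> complex_vector.span S = UNIV) \<and>
    faithful_state \<psi> \<and> (\<exists>\<delta>. delta_form \<psi> \<delta>)"

text \<open>The algebra is nonzero, so the number \<open>\<delta>\<close> of a quantum set is determined by \<open>\<psi>\<close>.\<close>

definition delta :: "('a::cstar_algebra \<Rightarrow> complex) \<Rightarrow> real"
  where "delta \<psi> = (THE \<delta>. delta_form \<psi> \<delta>)"

lemma delta_eq:
  assumes "delta_form \<psi> \<delta>"
  shows "delta \<psi> = \<delta>"
  unfolding delta_def
proof (rule the_equality)
  fix \<epsilon> assume "delta_form \<psi> \<epsilon>"
  with assms have eq: "complex_of_real (\<epsilon>\<^sup>2) *\<^sub>C (1::'a) = complex_of_real (\<delta>\<^sup>2) *\<^sub>C 1"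
    unfolding delta_form_def by (metis (no_types))
  then have "\<epsilon>\<^sup>2 = \<delta>\<^sup>2"
    by (simp only: complex_vector.scale_cancel_right of_real_eq_iff) simp
  with assms \<open>delta_form \<psi> \<epsilon>\<close> show "\<epsilon> = \<delta>"
    by (simp add: delta_form_def)
qed (fact assms)

definition schur ::
    "('a::cstar_algebra \<Rightarrow> complex) \<Rightarrow> ('a \<Rightarrow> 'a) \<Rightarrow> ('a \<Rightarrow> 'a) \<Rightarrow> 'a \<Rightarrow> 'a"
  where "schur \<psi> S T x =
    complex_of_real (1 / (delta \<psi>)\<^sup>2) *\<^sub>C mult_map (tensor_map S T (mult_adjoint \<psi> x))"

definition star_map :: "('a::cstar_algebra \<Rightarrow> 'a) \<Rightarrow> 'a \<Rightarrow> 'a"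
  where "star_map T x = star (T (star x))"

definition quantum_graph :: "('a::cstar_algebra \<Rightarrow> complex) \<Rightarrow> ('a \<Rightarrow> 'a) \<Rightarrow> bool"
  where "quantum_graph \<psi> A \<longleftrightarrow> quantum_set \<psi> \<and> clinear A \<and> schur \<psi> A A = A"

definition real_graph :: "('a::cstar_algebra \<Rightarrow> 'a) \<Rightarrow> bool"
  where "real_graph A \<longleftrightarrow> star_map A = A"

definition tracial :: "('a::cstar_algebra \<Rightarrow> complex) \<Rightarrow> bool"
  where "tracial \<psi> \<longleftrightarrow> (\<forall>x y. \<psi> (x * y) = \<psi> (y * x))"

text \<open>All linear operators on the finite-dimensional space \<open>L\<^sup>2(B, \<psi>)\<close> are bounded.\<close>

definition schur_central :: "('a::cstar_algebra \<Rightarrow> complex) \<Rightarrow> ('a \<Rightarrow> 'a) \<Rightarrow> bool"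
  where "schur_central \<psi> A \<longleftrightarrow> (\<forall>T. clinear T \<longrightarrow> schur \<psi> A T = schur \<psi> T A)"

definition quantum_relation :: "('a::cstar_algebra \<Rightarrow> complex) \<Rightarrow> ('a \<Rightarrow> 'a) \<Rightarrow> ('a \<Rightarrow> 'a) set"
  where "quantum_relation \<psi> A = schur \<psi> A ` {T. clinear T}"

definition hom_adjoint ::
    "('a::cstar_algebra \<Rightarrow> complex) \<Rightarrow> ('b::cstar_algebra \<Rightarrow> complex) \<Rightarrow> ('b \<Rightarrow> 'a) \<Rightarrow> 'a \<Rightarrow> 'b"
  where "hom_adjoint \<psi>\<^sub>0 \<psi>\<^sub>1 f = hilbert_adjoint (inner_state \<psi>\<^sub>1) (inner_state \<psi>\<^sub>0) f"

text \<open>The homomorphism notions below describe morphisms from \<open>(\<psi>\<^sub>0, A\<^sub>0)\<close> to \<open>(\<psi>\<^sub>1, A\<^sub>1)\<close>, while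
  the underlying unital *-homomorphism \<open>f\<close> goes the other way.\<close>

definition graph_homomorphism ::
    "('a::cstar_algebra \<Rightarrow> complex) \<Rightarrow> ('a \<Rightarrow> 'a) \<Rightarrow>
     ('b::cstar_algebra \<Rightarrow> complex) \<Rightarrow> ('b \<Rightarrow> 'b) \<Rightarrow> ('b \<Rightarrow> 'a) \<Rightarrow> bool"
  where "graph_homomorphism \<psi>\<^sub>0 A\<^sub>0 \<psi>\<^sub>1 A\<^sub>1 f \<longleftrightarrow>
    schur \<psi>\<^sub>1 A\<^sub>1 (hom_adjoint \<psi>\<^sub>0 \<psi>\<^sub>1 f \<circ> A\<^sub>0 \<circ> f) = hom_adjoint \<psi>\<^sub>0 \<psi>\<^sub>1 f \<circ> A\<^sub>0 \<circ> f"

definition loc_homomorphism ::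
    "('a::cstar_algebra \<Rightarrow> complex) \<Rightarrow> ('a \<Rightarrow> 'a) \<Rightarrow>
     ('b::cstar_algebra \<Rightarrow> complex) \<Rightarrow> ('b \<Rightarrow> 'b) \<Rightarrow> ('b \<Rightarrow> 'a) \<Rightarrow> bool"
  where "loc_homomorphism \<psi>\<^sub>0 A\<^sub>0 \<psi>\<^sub>1 A\<^sub>1 f \<longleftrightarrow>
    (\<lambda>X. hom_adjoint \<psi>\<^sub>0 \<psi>\<^sub>1 f \<circ> X \<circ> f) ` quantum_relation \<psi>\<^sub>0 A\<^sub>0 \<subseteq> quantum_relation \<psi>\<^sub>1 A\<^sub>1"

end

theory Submission
  imports Defs
begin

text \<open>
  Write \<open>*\<close> for the unnormalised Schur product \<open>S * T = m (S \<otimes> T) m\<^sup>\<dagger>\<close>.  For a tracial state the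
  operators on \<open>L\<^sup>2(B, \<psi>)\<close> with this product and the involution \<open>T \<mapsto> (x \<mapsto> star (T (star x)))\<close>
  form a copy of the *-algebra \<open>B \<otimes> B\<^sup>o\<^sup>p\<close>.  Its unit is \<open>x \<mapsto> \<psi> x 1\<close>, and \<open>T \<mapsto> \<psi> (T 1)\<close>
  is the faithful trace \<open>\<psi> \<otimes> \<psi>\<close>.  With \<open>P = \<delta>\<^sub>0\<^sup>-\<^sup>2 A\<^sub>0\<close> and \<open>R = \<delta>\<^sub>1\<^sup>-\<^sup>2 A\<^sub>1\<close>, the adjacency
  operators of real quantum graphs become self-adjoint idempotents, and the quantum relation is
  the right ideal \<open>P * B(L\<^sup>2)\<close>, respectively \<open>R * B(L\<^sup>2)\<close>.

  The homomorphism \<open>f\<close> gives two maps between these algebras.  Inflation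
  \<open>F(T) = f T f\<^sup>\<dagger>\<close> is a *-homomorphism, and compression \<open>E(X) = f\<^sup>\<dagger> X f\<close> is
  trace-preserving and a module map over it: \<open>T * E(X) = E(F(T) * X)\<close>
  (\<open>inflate_conv\<close>, \<open>star_map_inflate\<close>, \<open>state_f_adj\<close>, \<open>compress_conv_inflate\<close>).

  A graph homomorphism is the equation \<open>R * E(P) = E(P)\<close>, that is, \<open>Q * E(P) = 0\<close> for the
  complementary projection \<open>Q = 1 - R\<close>.  Then \<open>E(F(Q) * P) = 0\<close>, so the projections \<open>F(Q)\<close>
  and \<open>P\<close> have a product of trace zero, and since the trace is faithful the product itself is
  zero (\<open>projections_orthogonal\<close>).  Consequently \<open>Q * E(P * X) = E(F(Q) * P * X) = 0\<close> for every
  \<open>X\<close> (\<open>compress_support\<close>), which says that \<open>E\<close> maps the quantum relation of the source into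
  that of the target.  For the converse, \<open>A\<^sub>0\<close> lies in its own quantum relation, and left
  multiplication by \<open>R\<close> fixes every element of \<open>R * B(L\<^sup>2)\<close>.

  The identities for products are computed from \<open>m\<^sup>\<dagger> x = \<Sum>e. x e \<otimes> star e\<close>, where \<open>e\<close> runs over
  an orthonormal basis (\<open>mult_adjoint_eq\<close>).  The recurring step is to move a linear map from one leg
  of the Casimir tensor \<open>\<Sum>e. e \<otimes> star e\<close> to the other (\<open>casimir_transfer\<close>).
\<close>

section \<open>Complex-linear maps and the algebra of a C*-algebra\<close>

lemma clinear_iff:
  "clinear T \<longleftrightarrow> (\<forall>x y. T (x + y) = T x + T y) \<and> (\<forall>c x. T (c *\<^sub>C x) = c *\<^sub>C T x)"
  by (simp add: Vector_Spaces.linear_iff complex_vector.vector_space_axioms)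

lemma clinear_add: "clinear T \<Longrightarrow> T (x + y) = T x + T y"
  and clinear_scaleC: "clinear T \<Longrightarrow> T (c *\<^sub>C x) = c *\<^sub>C T x"
  by (simp_all add: clinear_iff)

lemma clinear_zero: "clinear T \<Longrightarrow> T 0 = 0"
  using clinear_add[of T 0 0] by simp

lemma clinear_sum: "clinear T \<Longrightarrow> T (\<Sum>i\<in>I. g i) = (\<Sum>i\<in>I. T (g i))"
  by (induction I rule: infinite_finite_induct) (simp_all add: clinear_zero clinear_add)

lemma clinear_diff: "clinear T \<Longrightarrow> T (x - y) = T x - T y"
  using clinear_add[of T "x - y" y] by (simp add: algebra_simps)

lemma clinear_minus: "clinear T \<Longrightarrow> T (- x) = - T x"
  using clinear_diff[of T 0 x] by (simp add: clinear_zero)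

lemma star_zero: "star (0::'a::cstar_algebra) = 0"
  using star_add[of "0::'a" 0] by simp

lemma star_sum: "star (\<Sum>i\<in>I. g i) = (\<Sum>i\<in>I. star (g i :: 'a::cstar_algebra))"
  by (induction I rule: infinite_finite_induct) (simp_all add: star_zero star_add)

lemma star_one: "star (1::'a::cstar_algebra) = 1"
  using star_mult[of "1::'a" "star 1"] by simp

lemma star_diff: "star (x - y) = star x - star (y :: 'a::cstar_algebra)"
  using star_add[of "x - y" y] by (simp add: algebra_simps)

lemmas algebra_linear = distrib_left distrib_right mult_scaleC_left mult_scaleC_right
  scaleC_add_right mult.assoc


section \<open>The inner product of a faithful state\<close>

lemma state_clinear: "faithful_state \<psi> \<Longrightarrow> clinear \<psi>"
  by (simp add: faithful_state_def)

lemma state_add: "faithful_state \<psi> \<Longrightarrow> \<psi> (x + y) = \<psi> x + \<psi> y"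
  and state_scaleC: "faithful_state \<psi> \<Longrightarrow> \<psi> (c *\<^sub>C x) = c * \<psi> x"
  and state_sum: "faithful_state \<psi> \<Longrightarrow> \<psi> (\<Sum>i\<in>I. g i) = (\<Sum>i\<in>I. \<psi> (g i))"
  and state_minus: "faithful_state \<psi> \<Longrightarrow> \<psi> (- x) = - \<psi> x"
  and state_diff: "faithful_state \<psi> \<Longrightarrow> \<psi> (x - y) = \<psi> x - \<psi> y"
  using clinear_add[OF state_clinear] clinear_scaleC[OF state_clinear]
    clinear_sum[OF state_clinear] clinear_minus[OF state_clinear] clinear_diff[OF state_clinear]
  by (auto simp: scaleC_complex_def)

text \<open>Polarisation: \<open>\<psi> (star y * y)\<close> is real for \<open>y = z\<close> and \<open>y = z + 1\<close>, so
  \<open>\<psi> (star z) + \<psi> z\<close> is real.  Taking \<open>z = x\<close> and \<open>z = \<i> x\<close> gives the imaginary and the real part.\<close>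

lemma state_star:
  assumes "faithful_state \<psi>"
  shows "\<psi> (star x) = cnj (\<psi> x)"
proof -
  have real: "Im (\<psi> (star y * y)) = 0" for y
    using assms by (auto simp: faithful_state_def complex_nonneg_Reals_iff)
  have Im_sum: "Im (\<psi> (star y) + \<psi> y) = 0" for y
  proof -
    have "star (y + 1) * (y + 1) = star y * y + (star y + (y + 1))"
      by (simp add: star_add star_one algebra_simps)
    then have "\<psi> (star (y + 1) * (y + 1)) = \<psi> (star y * y) + (\<psi> (star y) + (\<psi> y + 1))"
      using assms by (simp add: state_add faithful_state_def)
    then show ?thesis using real[of "y + 1"] real[of y] by simp
  qed
  show ?thesis
    using Im_sum[of x] Im_sum[of "\<i> *\<^sub>C x"] assms
    by (simp add: star_scaleC state_scaleC state_minus complex_eq_iff)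
qed

lemma state_nondegenerate:
  assumes "faithful_state \<psi>" and "\<And>x. \<psi> (x * y) = \<psi> (x * z)"
  shows "y = z"
proof -
  have "\<psi> (star (y - z) * (y - z)) = 0"
    using assms by (simp add: right_diff_distrib state_diff)
  then have "y - z = 0" using assms(1) unfolding faithful_state_def by blast
  then show ?thesis by simp
qed

text \<open>The Gram--Schmidt process, with the expansion formula itself as induction invariant: it says that
  \<open>p\<close> below is the orthogonal projection onto the span of \<open>S\<close>, so that \<open>v - p v\<close> is orthogonal to
  this span.\<close>

lemma finite_span_expansion:
  assumes \<psi>: "faithful_state \<psi>" and "finite S"
  shows "\<exists>E. finite E \<and> E \<subseteq> complex_vector.span S \<and>
    (\<forall>y\<in>complex_vector.span S. (\<Sum>e\<in>E. \<psi> (star e * y) *\<^sub>C e) = y)"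
  using \<open>finite S\<close>
proof (induction S rule: finite_induct)
  case empty
  show ?case by (intro exI[of _ "{}"]) simp
next
  case (insert v S)
  then obtain E where E: "finite E" "E \<subseteq> complex_vector.span S"
    and expand: "\<And>y. y \<in> complex_vector.span S \<Longrightarrow> (\<Sum>e\<in>E. \<psi> (star e * y) *\<^sub>C e) = y"
    by blast
  define p where "p y = (\<Sum>e\<in>E. \<psi> (star e * y) *\<^sub>C e)" for y
  define w where "w = v - p v"
  have span_mono: "y \<in> complex_vector.span S \<Longrightarrow> y \<in> complex_vector.span (insert v S)" for y
    using complex_vector.span_mono[of S "insert v S"] by blast
  have p_span: "p y \<in> complex_vector.span S" for y
    unfolding p_def using E
    by (intro complex_vector.span_sum complex_vector.span_scale) auto
  have p_add: "p (y + c *\<^sub>C z) = p y + c *\<^sub>C p z" for y z c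
    using \<psi> by (simp add: p_def algebra_linear state_add state_scaleC sum.distrib
        scaleC_add_left complex_vector.scale_sum_right)
  have p_adjoint: "\<psi> (star (p y) * z) = \<psi> (star y * p z)" for y z
  proof -
    have "cnj (\<psi> (star e * y)) = \<psi> (star y * e)" for e
      using state_star[OF \<psi>, of "star e * y"] by (simp add: star_mult)
    then show ?thesis
      using \<psi> by (simp add: p_def star_sum star_scaleC sum_distrib_left sum_distrib_right
          mult_scaleC_left mult_scaleC_right state_sum state_scaleC mult.commute)
  qed
  have w_orth: "\<psi> (star w * y) = 0" if "y \<in> complex_vector.span S" for y
    using p_adjoint[of v y] expand[OF that] \<psi>
    by (simp add: w_def star_diff left_diff_distrib state_diff p_def)
  have decomposition: "\<exists>c. \<exists>z\<in>complex_vector.span S. y = z + c *\<^sub>C w"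
    if "y \<in> complex_vector.span (insert v S)" for y
  proof -
    from that obtain c where c: "y - c *\<^sub>C v \<in> complex_vector.span S"
      by (auto simp: complex_vector.span_insert)
    have "y = (y - c *\<^sub>C v + c *\<^sub>C p v) + c *\<^sub>C w"
      by (simp add: w_def complex_vector.scale_right_diff_distrib)
    moreover have "y - c *\<^sub>C v + c *\<^sub>C p v \<in> complex_vector.span S"
      using c p_span by (intro complex_vector.span_add complex_vector.span_scale)
    ultimately show ?thesis by blast
  qed
  have p_fix: "p y = y" if "y \<in> complex_vector.span S" for y
    using expand[OF that] by (simp add: p_def)
  \<comment> \<open>If \<open>v\<close> depends on \<open>S\<close> the old set still serves; otherwise the normalised \<open>w\<close> is added.\<close>
  show ?case
  proof (cases "w = 0")
    case True
    then have "complex_vector.span (insert v S) \<subseteq> complex_vector.span S"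
      using decomposition by fastforce
    then show ?thesis using E expand span_mono by (intro exI[of _ E]) blast
  next
    case False
    define n where "n = sqrt (Re (\<psi> (star w * w)))"
    have "\<psi> (star w * w) \<noteq> 0" "\<psi> (star w * w) \<in> \<real>\<^sub>\<ge>\<^sub>0"
      using \<psi> False by (auto simp: faithful_state_def)
    then have n: "n > 0" "\<psi> (star w * w) = complex_of_real (n\<^sup>2)"
      by (auto simp: n_def complex_nonneg_Reals_iff complex_eq_iff)
    define u where "u = complex_of_real (1 / n) *\<^sub>C w"
    have u_orth: "\<psi> (star u * y) = 0" if "y \<in> complex_vector.span S" for y
      using w_orth[OF that] \<psi> by (simp add: u_def star_scaleC mult_scaleC_left state_scaleC)
    have u_w: "\<psi> (star u * w) *\<^sub>C u = w"
      using \<psi> n by (simp add: u_def star_scaleC mult_scaleC_left state_scaleC power2_eq_square)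
    have u_new: "u \<notin> E"
    proof
      assume "u \<in> E"
      then have "\<psi> (star u * u) = 0" using u_orth E(2) by blast
      then have "u = 0" using \<psi> by (simp add: faithful_state_def)
      with False n(1) show False by (simp add: u_def)
    qed
    have p_w: "p w = 0"
      using p_add[of v "-1" "p v"] p_fix[OF p_span] by (simp add: w_def)
    have "(\<Sum>e\<in>insert u E. \<psi> (star e * y) *\<^sub>C e) = y"
      if y_span: "y \<in> complex_vector.span (insert v S)" for y
    proof -
      obtain c z where z: "z \<in> complex_vector.span S" and y: "y = z + c *\<^sub>C w"
        using decomposition[OF y_span] by blast
      have "\<psi> (star u * y) *\<^sub>C u = c *\<^sub>C (\<psi> (star u * w) *\<^sub>C u)"
        using \<psi> u_orth[OF z] by (simp add: y algebra_linear state_add state_scaleC)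
      then have "\<psi> (star u * y) *\<^sub>C u = c *\<^sub>C w" using u_w by simp
      moreover have "p y = z" using p_add[of z c w] p_w p_fix[OF z] by (simp add: y)
      ultimately show ?thesis
        using E(1) u_new by (simp add: y p_def add.commute)
    qed
    moreover have "u \<in> complex_vector.span (insert v S)"
      unfolding u_def w_def
      by (intro complex_vector.span_scale complex_vector.span_diff span_mono p_span
          complex_vector.span_base) simp
    ultimately show ?thesis
      using E span_mono by (intro exI[of _ "insert u E"]) auto
  qed
qed


section \<open>Tensors\<close>

lemma tensor_induct [case_names pure scaleC add]:
  fixes t :: "('a::complex_vector, 'b::complex_vector) tensor"
  assumes pure: "\<And>a b. P (a \<otimes>\<^sub>C b)"
    and scaleC: "\<And>c t. P t \<Longrightarrow> P (c *\<^sub>C t)"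
    and add: "\<And>s t. P s \<Longrightarrow> P t \<Longrightarrow> P (s + t)"
  shows "P t"
proof (induction t)
  fix u :: "('a, 'b) formal_tensor"
  have zero: "P 0" using scaleC[OF pure, of 0 0 0] by simp
  show "P (abs_tensor u)"
  proof (induction u rule: update_induct)
    case const
    then show ?case using zero by (simp add: zero_tensor.abs_eq)
  next
    case (update u k v)
    have "Poly_Mapping.update k v u = formal_scale v (formal_pure (fst k) (snd k)) + u"
      using update(1)
      by (intro poly_mapping_eqI)
        (auto simp: formal_pure_def lookup_single lookup_update lookup_add when_def in_keys_iff)
    then have "abs_tensor (Poly_Mapping.update k v u) = v *\<^sub>C (fst k \<otimes>\<^sub>C snd k) + abs_tensor u"
      by (simp add: scaleC_tensor.abs_eq pure_tensor.abs_eq plus_tensor.abs_eq)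
    then show ?case using add[OF scaleC[OF pure] update(3)] by simp
  qed
qed

lemmas pure_tensor_linear = pure_tensor_add_left pure_tensor_add_right
  pure_tensor_scaleC_left pure_tensor_scaleC_right

text \<open>The inner product on tensors is an iterated extension from pure tensors.  The well-definedness
  of each layer is needed before sesquilinearity can be read off.\<close>

lemma semi_bilinear_star:
  "semi_bilinear cnj (\<lambda>(a::'a::cstar_algebra) (b::'b::cstar_algebra). star a \<otimes>\<^sub>C star b)"
  by (simp add: semi_bilinear_def pure_tensor_linear star_add star_scaleC)

lemma semi_bilinear_times_pure:
  "semi_bilinear id (\<lambda>(c::'a::cstar_algebra) (d::'b::cstar_algebra). (a * c) \<otimes>\<^sub>C (b * d))"
  by (simp add: semi_bilinear_def pure_tensor_linear algebra_linear)

lemma semi_bilinear_times: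
  "semi_bilinear id (\<lambda>(a::'a::cstar_algebra) (b::'b::cstar_algebra).
    tensor_extend id (\<lambda>c d. (a * c) \<otimes>\<^sub>C (b * d)) t)"
proof (induction t rule: tensor_induct)
  case (pure a b)
  show ?case unfolding tensor_extend_pure[OF semi_bilinear_times_pure]
    by (simp add: semi_bilinear_def id_def pure_tensor_linear algebra_linear)
next
  case (scaleC c t)
  then show ?case unfolding tensor_extend_scaleC[OF semi_bilinear_times_pure]
    by (simp add: semi_bilinear_def id_def scaleC_add_right mult.commute)
next
  case (add s t)
  then show ?case unfolding tensor_extend_add[OF semi_bilinear_times_pure]
    by (simp add: semi_bilinear_def id_def scaleC_add_right algebra_simps)
qed

lemma semi_bilinear_functional:
  fixes \<psi> :: "'a::complex_vector \<Rightarrow> complex" and \<chi> :: "'b::complex_vector \<Rightarrow> complex"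
  shows "clinear \<psi> \<Longrightarrow> clinear \<chi> \<Longrightarrow> semi_bilinear id (\<lambda>a b. \<psi> a * \<chi> b)"
  by (simp add: semi_bilinear_def clinear_iff scaleC_complex_def algebra_simps)

lemma inner_tensor_add_left:
    "clinear \<psi> \<Longrightarrow> inner_tensor \<psi> (s + s') t = inner_tensor \<psi> s t + inner_tensor \<psi> s' t"
  and inner_tensor_scaleC_left:
    "clinear \<psi> \<Longrightarrow> inner_tensor \<psi> (c *\<^sub>C s) t = cnj c * inner_tensor \<psi> s t"
  by (simp_all add: inner_tensor_def tensor_star_def tensor_times_def tensor_functional_def
      tensor_extend_add[OF semi_bilinear_star] tensor_extend_scaleC[OF semi_bilinear_star]
      tensor_extend_add[OF semi_bilinear_times] tensor_extend_scaleC[OF semi_bilinear_times]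
      tensor_extend_add[OF semi_bilinear_functional] tensor_extend_scaleC[OF semi_bilinear_functional]
      scaleC_complex_def)

lemma clinear_inner_tensor_pure:
  assumes "clinear \<psi>"
  shows "clinear (inner_tensor \<psi> (a \<otimes>\<^sub>C b))"
proof -
  have "inner_tensor \<psi> (a \<otimes>\<^sub>C b) t = tensor_functional \<psi> \<psi>
      (tensor_extend id (\<lambda>c d. (star a * c) \<otimes>\<^sub>C (star b * d)) t)" for t
    by (simp only: inner_tensor_def tensor_star_def tensor_times_def
        tensor_extend_pure[OF semi_bilinear_star] tensor_extend_pure[OF semi_bilinear_times])
  with assms show ?thesis
    by (simp add: clinear_iff[of "inner_tensor _ _"] tensor_functional_def scaleC_complex_def
      tensor_extend_add[OF semi_bilinear_times_pure] tensor_extend_scaleC[OF semi_bilinear_times_pure]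
      tensor_extend_add[OF semi_bilinear_functional] tensor_extend_scaleC[OF semi_bilinear_functional])
qed

lemma clinear_mult_map: "clinear (mult_map :: ('a::cstar_algebra, 'a) tensor \<Rightarrow> 'a)"
proof -
  have "semi_bilinear id ((*) :: 'a \<Rightarrow> 'a \<Rightarrow> 'a)"
    by (simp add: semi_bilinear_def algebra_linear)
  then show ?thesis
    by (simp add: clinear_iff mult_map_def tensor_extend_add tensor_extend_scaleC)
qed

lemma clinear_tensor_map:
  assumes "clinear S" "clinear T"
  shows "clinear (tensor_map S T)"
proof -
  have "semi_bilinear id (\<lambda>a b. S a \<otimes>\<^sub>C T b)"
    using assms by (simp add: semi_bilinear_def clinear_iff pure_tensor_linear)
  then show ?thesis
    by (simp add: clinear_iff tensor_map_def tensor_extend_add tensor_extend_scaleC)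
qed

lemma hilbert_adjoint_eqI:
  assumes "\<And>v w. ipw (F v) w = ipv v (G w)"
    and "\<And>y z. (\<And>v. ipv v y = ipv v z) \<Longrightarrow> y = z"
  shows "hilbert_adjoint ipv ipw F = G"
  unfolding hilbert_adjoint_def
proof (rule the_equality)
  fix G' assume "\<forall>v w. ipw (F v) w = ipv v (G' w)"
  then have "ipv v (G' w) = ipv v (G w)" for v w using assms(1) by metis
  then show "G' = G" using assms(2) by blast
qed (use assms(1) in blast)


section \<open>The Casimir tensor and the adjoint of multiplication\<close>

text \<open>The elements of \<open>E\<close> serve as an orthonormal basis of \<open>L\<^sup>2(B, \<psi>)\<close>; the expansion formula is the
  form in which this is used.\<close>

locale tracial_expansion =
  fixes \<psi> :: "'a::cstar_algebra \<Rightarrow> complex" and E :: "'a set"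
  assumes state: "faithful_state \<psi>"
    and trace: "\<psi> (x * y) = \<psi> (y * x)"
    and finite_E: "finite E"
    and expansion: "(\<Sum>e\<in>E. \<psi> (star e * y) *\<^sub>C e) = y"
begin

text \<open>By traciality \<open>x \<mapsto> star x\<close> preserves orthonormal bases, so the starred family expands as well.\<close>

lemma star_expansion: "(\<Sum>e\<in>E. \<psi> (e * y) *\<^sub>C star e) = y"
proof -
  have "star (\<Sum>e\<in>E. \<psi> (star e * star y) *\<^sub>C e) = y" by (simp add: expansion)
  moreover have "cnj (\<psi> (star e * star y)) = \<psi> (e * y)" for e
    using state_star[OF state, of "star e * star y"] trace[of e y] by (simp add: star_mult)
  ultimately show ?thesis by (simp add: star_sum star_scaleC)
qed

lemma clinear_expansion: "clinear T \<Longrightarrow> T y = (\<Sum>e\<in>E. \<psi> (star e * y) *\<^sub>C T e)"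
  using clinear_sum[of T "\<lambda>e. \<psi> (star e * y) *\<^sub>C e" E] by (simp add: expansion clinear_scaleC)

lemma clinear_star_expansion: "clinear T \<Longrightarrow> T y = (\<Sum>e\<in>E. \<psi> (e * y) *\<^sub>C T (star e))"
  using clinear_sum[of T "\<lambda>e. \<psi> (e * y) *\<^sub>C star e" E]
  by (simp add: star_expansion clinear_scaleC)

text \<open>The coefficient of \<open>e\<close> in the left leg of a tensor, with values in the right leg.  It is used
  to test equality of tensors.\<close>

definition slice :: "'a \<Rightarrow> ('a, 'c::complex_vector) tensor \<Rightarrow> 'c"
  where "slice e = tensor_extend id (\<lambda>a b. \<psi> (star e * a) *\<^sub>C b)"

lemma slice_pure: "slice e (a \<otimes>\<^sub>C b) = \<psi> (star e * a) *\<^sub>C b"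
  and slice_scaleC: "slice e (c *\<^sub>C t) = c *\<^sub>C slice e t"
  and slice_add: "slice e (s + t) = slice e s + slice e t"
proof -
  have "semi_bilinear id (\<lambda>a b. \<psi> (star e * a) *\<^sub>C b)"
    using state by (simp add: semi_bilinear_def algebra_linear state_add state_scaleC
        scaleC_add_left mult.commute)
  note this[THEN tensor_extend_pure] this[THEN tensor_extend_scaleC] this[THEN tensor_extend_add]
  then show "slice e (a \<otimes>\<^sub>C b) = \<psi> (star e * a) *\<^sub>C b" "slice e (c *\<^sub>C t) = c *\<^sub>C slice e t"
      "slice e (s + t) = slice e s + slice e t"
    by (simp_all add: slice_def)
qed

lemma tensor_expansion: "(\<Sum>e\<in>E. e \<otimes>\<^sub>C slice e t) = t"
proof (induction t rule: tensor_induct)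
  case (pure a b)
  have "clinear (\<lambda>a. a \<otimes>\<^sub>C b)" by (simp add: clinear_iff pure_tensor_linear)
  from clinear_expansion[OF this, of a, symmetric] show ?case
    by (simp add: slice_pure pure_tensor_linear)
next
  case (scaleC c t)
  then show ?case
    by (simp add: slice_scaleC pure_tensor_linear flip: complex_vector.scale_sum_right)
next
  case (add s t)
  then show ?case by (simp add: slice_add pure_tensor_linear sum.distrib)
qed

lemma inner_tensor_nondegenerate:
  assumes eq: "\<And>s. inner_tensor \<psi> s t = inner_tensor \<psi> s t'"
  shows "t = t'"
proof -
  note lin = state_clinear[OF state]
  have inner: "inner_tensor \<psi> (e \<otimes>\<^sub>C star x) r = \<psi> (x * slice e r)" for e x r
  proof (induction r rule: tensor_induct)
    case (pure a b)
    then show ?case using state lin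
      by (simp add: slice_pure inner_tensor_pure inner_state_def mult_scaleC_right state_scaleC)
  next
    case (scaleC c t)
    then show ?case using state
      by (simp add: slice_scaleC clinear_scaleC[OF clinear_inner_tensor_pure[OF lin]]
          scaleC_complex_def mult_scaleC_right state_scaleC)
  next
    case (add s t)
    then show ?case using state
      by (simp add: slice_add clinear_add[OF clinear_inner_tensor_pure[OF lin]] distrib_left state_add)
  qed
  have slices: "slice e t = slice e t'" for e
  proof (rule state_nondegenerate[OF state])
    show "\<psi> (x * slice e t) = \<psi> (x * slice e t')" for x
      by (simp only: inner[symmetric] eq)
  qed
  have "t = (\<Sum>e\<in>E. e \<otimes>\<^sub>C slice e t)" by (rule tensor_expansion[symmetric])
  also have "\<dots> = t'" by (simp only: slices tensor_expansion)
  finally show ?thesis .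
qed

text \<open>On pure tensors the defining equation of the adjoint is
  \<open>\<psi> (star (a b) x) = \<psi> (star a x star b)\<close> with the factor \<open>star b\<close> expanded over \<open>E\<close>;
  moving \<open>star b\<close> to the right is where traciality is used.\<close>

lemma mult_adjoint_eq: "mult_adjoint \<psi> = (\<lambda>x. \<Sum>e\<in>E. (x * e) \<otimes>\<^sub>C star e)"
  unfolding mult_adjoint_def
proof (rule hilbert_adjoint_eqI)
  fix t :: "('a, 'a) tensor" and x
  note lin = state_clinear[OF state]
  show "inner_state \<psi> (mult_map t) x = inner_tensor \<psi> t (\<Sum>e\<in>E. (x * e) \<otimes>\<^sub>C star e)"
  proof (induction t rule: tensor_induct)
    case (pure a b)
    have "inner_tensor \<psi> (a \<otimes>\<^sub>C b) (\<Sum>e\<in>E. (x * e) \<otimes>\<^sub>C star e)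
        = (\<Sum>e\<in>E. \<psi> (star a * (x * e)) * \<psi> (star b * star e))"
      using lin by (simp add: clinear_sum clinear_inner_tensor_pure inner_tensor_pure inner_state_def)
    also have "\<dots> = (\<Sum>e\<in>E. \<psi> (star e * star b) * \<psi> (star a * x * e))"
      using trace[of "star b"] by (simp add: mult.assoc mult.commute)
    also have "\<dots> = \<psi> (star a * x * (\<Sum>e\<in>E. \<psi> (star e * star b) *\<^sub>C e))"
      using state by (simp add: sum_distrib_left mult_scaleC_right state_sum state_scaleC)
    also have "\<dots> = \<psi> (star b * (star a * x))"
      by (subst expansion, rule trace)
    finally show ?case by (simp add: mult_map_pure inner_state_def star_mult mult.assoc)
  next
    case (scaleC c t)
    then show ?case using lin state
      by (simp add: inner_tensor_scaleC_left clinear_scaleC[OF clinear_mult_map] inner_state_def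
          star_scaleC mult_scaleC_left state_scaleC)
  next
    case (add s t)
    then show ?case using lin state
      by (simp add: inner_tensor_add_left clinear_add[OF clinear_mult_map] inner_state_def
          star_add distrib_right state_add)
  qed
qed (rule inner_tensor_nondegenerate)

text \<open>Traciality makes the Casimir tensor \<open>\<Sum>e. e \<otimes> star e\<close> invariant under the flip.  Here and
  below a tensor is tested against an arbitrary bilinear map \<open>h\<close>.\<close>

lemma casimir_symmetric:
  assumes h1: "\<And>y. clinear (\<lambda>x. h x y)" and h2: "\<And>x. clinear (h x)"
  shows "(\<Sum>e\<in>E. h (star e) e) = (\<Sum>e\<in>E. h e (star e))"
proof -
  have "(\<Sum>e\<in>E. h (star e) e) = (\<Sum>e\<in>E. \<Sum>k\<in>E. \<psi> (k * e) *\<^sub>C h (star e) (star k))"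
    by (intro sum.cong refl clinear_star_expansion h2)
  also have "\<dots> = (\<Sum>k\<in>E. \<Sum>e\<in>E. \<psi> (e * k) *\<^sub>C h (star e) (star k))"
    by (subst sum.swap) (simp add: trace)
  also have "\<dots> = (\<Sum>k\<in>E. h k (star k))"
    by (intro sum.cong refl clinear_star_expansion[symmetric] h1)
  finally show ?thesis .
qed

end

text \<open>A linear map acting on the left leg of one Casimir tensor equals its transpose, with respect to
  the bilinear trace forms, acting on the right leg of the other: expand the left leg in \<open>E\<close>, then
  collapse the sum over \<open>D\<close>.  The transposed pairs used below are left and right multiplication by an
  element, the pair \<open>f\<^sup>\<dagger>\<close> and \<open>f\<close>, and a combination of both.\<close>

lemma casimir_transfer:
  assumes "tracial_expansion \<psi> E" "tracial_expansion \<chi> D"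
    and adj: "\<And>x y. \<psi> (G x * y) = \<chi> (x * H y)"
    and h1: "\<And>y. clinear (\<lambda>x. h x y)" and h2: "\<And>x. clinear (h x)"
  shows "(\<Sum>d\<in>D. h (G d) (star d)) = (\<Sum>e\<in>E. h e (H (star e)))"
proof -
  interpret E: tracial_expansion \<psi> E by fact
  interpret D: tracial_expansion \<chi> D by fact
  have "(\<Sum>d\<in>D. h (G d) (star d)) = (\<Sum>d\<in>D. \<Sum>e\<in>E. \<psi> (star e * G d) *\<^sub>C h e (star d))"
    by (intro sum.cong refl E.clinear_expansion h1)
  also have "\<dots> = (\<Sum>e\<in>E. \<Sum>d\<in>D. \<chi> (d * H (star e)) *\<^sub>C h e (star d))"
    by (subst sum.swap) (simp add: adj[symmetric] E.trace)
  also have "\<dots> = (\<Sum>e\<in>E. h e (H (star e)))"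
    by (intro sum.cong refl D.clinear_star_expansion[symmetric] h2)
  finally show ?thesis .
qed

lemma (in tracial_expansion) casimir_balanced:
  assumes "\<And>y. clinear (\<lambda>x. h x y)" and "\<And>x. clinear (h x)"
  shows "(\<Sum>e\<in>E. h (c * e) (star e)) = (\<Sum>e\<in>E. h e (star e * c))"
proof (rule casimir_transfer[where G = "\<lambda>x. c * x" and H = "\<lambda>y. y * c", OF _ _ _ assms])
  show "\<psi> (c * x * y) = \<psi> (x * (y * c))" for x y
    using trace[of c "x * y"] by (simp add: mult.assoc)
qed (rule tracial_expansion_axioms)+


section \<open>The convolution algebra of operators\<close>

context tracial_expansion
begin

text \<open>The Schur product without its normalising factor.  Without the factor, transport along \<open>f\<close>
  needs no bookkeeping of the two numbers \<open>\<delta>\<close>.\<close>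

definition conv :: "('a \<Rightarrow> 'a) \<Rightarrow> ('a \<Rightarrow> 'a) \<Rightarrow> 'a \<Rightarrow> 'a"
  where "conv S T x = (\<Sum>e\<in>E. S (x * e) * T (star e))"

lemma schur_eq_conv:
  assumes "clinear S" "clinear T"
  shows "schur \<psi> S T = conv (\<lambda>x. complex_of_real (1 / (delta \<psi>)\<^sup>2) *\<^sub>C S x) T"
  using assms
  by (simp add: fun_eq_iff schur_def mult_adjoint_eq conv_def clinear_sum[OF clinear_tensor_map]
      clinear_sum[OF clinear_mult_map] tensor_map_pure mult_map_pure mult_scaleC_left
      complex_vector.scale_sum_right)

lemma clinear_conv: "clinear S \<Longrightarrow> clinear (conv S T)"
  by (simp add: clinear_iff conv_def algebra_linear sum.distrib complex_vector.scale_sum_right)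

lemma conv_diff_left: "conv (\<lambda>x. S x - S' x) T = (\<lambda>x. conv S T x - conv S' T x)"
  by (simp add: conv_def fun_eq_iff left_diff_distrib sum_subtractf)

lemma conv_diff_right: "conv S (\<lambda>x. T x - T' x) = (\<lambda>x. conv S T x - conv S T' x)"
  by (simp add: conv_def fun_eq_iff right_diff_distrib sum_subtractf)

lemma conv_zero_left: "conv (\<lambda>x. 0) T = (\<lambda>x. 0)"
  by (simp add: conv_def fun_eq_iff)

text \<open>Associativity rests on coassociativity of \<open>m\<^sup>\<dagger>\<close>, which amounts to the balancing property of the
  Casimir tensor.\<close>

lemma conv_assoc:
  assumes S: "clinear S" and T: "clinear T" and U: "clinear U"
  shows "conv (conv S T) U = conv S (conv T U)"
proof
  fix x
  have "conv (conv S T) U x = (\<Sum>e\<in>E. \<Sum>d\<in>E. S (x * (e * d)) * T (star d) * U (star e))"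
    by (simp add: conv_def sum_distrib_right mult.assoc)
  also have "\<dots> = (\<Sum>e\<in>E. \<Sum>d\<in>E. S (x * d) * T (star d * e) * U (star e))"
    using S T
    by (intro sum.cong refl casimir_balanced[where h = "\<lambda>a b. S (x * a) * T b * U _"])
      (simp_all add: clinear_iff algebra_linear)
  also have "\<dots> = (\<Sum>d\<in>E. \<Sum>e\<in>E. S (x * d) * T (star d * e) * U (star e))"
    by (rule sum.swap)
  also have "\<dots> = conv S (conv T U) x"
    by (simp add: conv_def sum_distrib_left mult.assoc)
  finally show "conv (conv S T) U x = conv S (conv T U) x" .
qed

definition conv_unit :: "'a \<Rightarrow> 'a"
  where "conv_unit x = \<psi> x *\<^sub>C 1"

lemma clinear_conv_unit: "clinear conv_unit"
  using state by (simp add: clinear_iff conv_unit_def state_add state_scaleC scaleC_add_left)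

lemma conv_unit_left:
  assumes "clinear T"
  shows "conv conv_unit T = T"
proof
  fix x
  show "conv conv_unit T x = T x"
    using clinear_star_expansion[OF assms, of x]
    by (simp add: conv_def conv_unit_def mult_scaleC_left trace[of x])
qed

lemma conv_unit_right:
  assumes "clinear T"
  shows "conv T conv_unit = T"
proof
  fix x
  have "conv T conv_unit x = (\<Sum>e\<in>E. \<psi> (star e) *\<^sub>C T (x * e))"
    by (simp add: conv_def conv_unit_def mult_scaleC_right)
  also have "\<dots> = T (x * (\<Sum>e\<in>E. \<psi> (star e * 1) *\<^sub>C e))"
    using assms by (simp add: sum_distrib_left mult_scaleC_right clinear_sum clinear_scaleC)
  finally show "conv T conv_unit x = T x" using expansion[of 1] by simp
qed

lemma star_map_conv_unit: "star_map conv_unit = conv_unit"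
  by (simp add: fun_eq_iff star_map_def conv_unit_def star_scaleC star_one state_star[OF state])

lemma clinear_star_map: "clinear T \<Longrightarrow> clinear (star_map T)"
  by (simp add: clinear_iff star_map_def star_add star_scaleC)

lemma star_map_conv:
  assumes "clinear S" "clinear T"
  shows "star_map (conv S T) = conv (star_map T) (star_map S)"
proof
  fix x
  have "star_map (conv S T) x = (\<Sum>e\<in>E. star_map T e * star_map S (star e * x))"
    by (simp add: star_map_def conv_def star_sum star_mult)
  also have "\<dots> = (\<Sum>e\<in>E. star_map T (x * e) * star_map S (star e))"
    using assms[THEN clinear_star_map]
    by (intro casimir_balanced[symmetric, where h = "\<lambda>a b. star_map T a * star_map S b"])
      (simp_all add: clinear_iff algebra_linear)
  finally show "star_map (conv S T) x = conv (star_map T) (star_map S) x"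
    by (simp add: conv_def)
qed

lemma conv_trace:
  assumes "clinear S" "clinear T"
  shows "\<psi> (conv S T 1) = \<psi> (conv T S 1)"
proof -
  have "\<psi> (conv S T 1) = (\<Sum>e\<in>E. \<psi> (T (star e) * S e))"
    using state by (simp add: conv_def state_sum trace[of "S _"])
  also have "\<dots> = (\<Sum>e\<in>E. \<psi> (T e * S (star e)))"
    using assms state
    by (intro casimir_symmetric[where h = "\<lambda>a b. \<psi> (T a * S b)"])
      (simp_all add: clinear_iff algebra_linear state_add state_scaleC scaleC_complex_def)
  finally show ?thesis using state by (simp add: conv_def state_sum)
qed

text \<open>The trace of \<open>star_map S * S\<close> is \<open>\<Sum>e. \<parallel>S (star e)\<parallel>\<^sup>2\<close> in the norm of \<open>L\<^sup>2(B, \<psi>)\<close>, and the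
  elements \<open>star e\<close> span the algebra.\<close>

lemma conv_faithful:
  assumes S: "clinear S" and zero: "\<psi> (conv (star_map S) S 1) = 0"
  shows "S = (\<lambda>x. 0)"
proof
  fix x
  have nonneg: "\<psi> (star y * y) \<in> \<real>\<^sub>\<ge>\<^sub>0" and faithful: "\<psi> (star y * y) = 0 \<Longrightarrow> y = 0" for y
    using state by (auto simp: faithful_state_def)
  have "(\<Sum>e\<in>E. Re (\<psi> (star (S (star e)) * S (star e)))) = Re (\<psi> (conv (star_map S) S 1))"
    using state by (simp add: conv_def star_map_def state_sum)
  then have "\<forall>e\<in>E. Re (\<psi> (star (S (star e)) * S (star e))) = 0"
    using nonneg zero finite_E
    by (subst sum_nonneg_eq_0_iff[symmetric]) (auto simp: complex_nonneg_Reals_iff)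
  then have "S (star e) = 0" if "e \<in> E" for e
    using nonneg faithful that by (auto simp: complex_nonneg_Reals_iff complex_eq_iff)
  then show "S x = 0" by (simp add: clinear_star_expansion[OF S, of x])
qed

text \<open>For projections, \<open>star_map (Q * P) * (Q * P) = P * Q * P\<close> has by cyclicity the same trace as
  \<open>Q * P\<close>.\<close>

lemma projections_orthogonal:
  assumes P: "clinear P" "conv P P = P" "star_map P = P"
    and Q: "clinear Q" "conv Q Q = Q" "star_map Q = Q"
    and zero: "\<psi> (conv Q P 1) = 0"
  shows "conv Q P = (\<lambda>x. 0)"
proof (rule conv_faithful)
  have "conv Q (conv Q P) = conv Q P"
    using P Q by (simp flip: conv_assoc)
  then have "conv (star_map (conv Q P)) (conv Q P) = conv P (conv Q P)"
    using P Q by (simp add: star_map_conv conv_assoc clinear_conv)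
  moreover have "conv (conv Q P) P = conv Q P"
    using P Q by (simp add: conv_assoc)
  ultimately show "\<psi> (conv (star_map (conv Q P)) (conv Q P) 1) = 0"
    using conv_trace[of P "conv Q P"] P Q zero by (simp add: clinear_conv)
qed (use P Q in \<open>simp add: clinear_conv\<close>)

end


section \<open>Transport along a unital *-homomorphism\<close>

locale tracial_hom =
  dom: tracial_expansion \<psi> E + cod: tracial_expansion \<chi> D
  for \<psi> :: "'b::cstar_algebra \<Rightarrow> complex" and E
    and \<chi> :: "'a::cstar_algebra \<Rightarrow> complex" and D +
  fixes f :: "'b \<Rightarrow> 'a"
  assumes hom: "unital_star_hom f"
begin

lemma f_clinear: "clinear f"
  and f_one: "f 1 = 1"
  and f_mult: "f (x * y) = f x * f y"
  and f_star: "f (star x) = star (f x)"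
  using hom by (auto simp: unital_star_hom_def)

abbreviation f_adj :: "'a \<Rightarrow> 'b"  (\<open>f\<^sup>\<dagger>\<close>)
  where "f\<^sup>\<dagger> \<equiv> hom_adjoint \<chi> \<psi> f"

text \<open>The sum is the explicit form of \<open>f\<^sup>\<dagger> z\<close>: the expansion of \<open>f\<^sup>\<dagger> z\<close> over \<open>E\<close> with the
  coefficients that the adjoint relation prescribes.\<close>

lemma hom_transpose:
  "\<psi> (y * (\<Sum>e\<in>E. \<chi> (star (f e) * z) *\<^sub>C e)) = \<chi> (f y * z)"
proof -
  have "\<psi> (y * (\<Sum>e\<in>E. \<chi> (star (f e) * z) *\<^sub>C e)) = (\<Sum>e\<in>E. \<psi> (e * y) * \<chi> (star (f e) * z))"
    using dom.state
    by (simp add: sum_distrib_left mult_scaleC_right state_sum state_scaleC dom.trace[of y]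
        mult.commute)
  also have "\<dots> = \<chi> (f (\<Sum>e\<in>E. \<psi> (e * y) *\<^sub>C star e) * z)"
    using cod.state f_clinear
    by (simp add: clinear_sum clinear_scaleC f_star sum_distrib_right mult_scaleC_left state_sum
        state_scaleC)
  finally show ?thesis by (simp only: dom.star_expansion)
qed

lemma f_adj_eq: "f\<^sup>\<dagger> = (\<lambda>z. \<Sum>e\<in>E. \<chi> (star (f e) * z) *\<^sub>C e)"
  unfolding hom_adjoint_def
proof (rule hilbert_adjoint_eqI)
  show "inner_state \<chi> (f v) z = inner_state \<psi> v (\<Sum>e\<in>E. \<chi> (star (f e) * z) *\<^sub>C e)" for v z
    by (simp only: inner_state_def hom_transpose f_star)
next
  fix y z assume *: "inner_state \<psi> v y = inner_state \<psi> v z" for v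
  show "y = z"
    by (rule state_nondegenerate[OF dom.state]) (metis * inner_state_def star_star)
qed

lemma f_adj_clinear: "clinear f\<^sup>\<dagger>"
  using cod.state by (simp add: clinear_iff f_adj_eq algebra_linear state_add state_scaleC scaleC_add_left
      sum.distrib complex_vector.scale_sum_right)

lemma f_adj_left: "\<psi> (y * f\<^sup>\<dagger> x) = \<chi> (f y * x)"
  by (simp only: f_adj_eq hom_transpose)

lemma f_adj_right: "\<psi> (f\<^sup>\<dagger> x * y) = \<chi> (x * f y)"
  using f_adj_left[of y x] by (simp add: dom.trace[of y] cod.trace[of x])

text \<open>Linearity over the image of \<open>f\<close>, as for a conditional expectation; it is the transpose of
  multiplicativity of \<open>f\<close>.\<close>

lemma f_adj_module: "f\<^sup>\<dagger> (f a * x) = a * f\<^sup>\<dagger> x"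
proof (rule state_nondegenerate[OF dom.state])
  show "\<psi> (y * f\<^sup>\<dagger> (f a * x)) = \<psi> (y * (a * f\<^sup>\<dagger> x))" for y
    using f_adj_left[of "y * a" x] by (simp add: f_adj_left f_mult mult.assoc)
qed

lemma f_adj_star: "f\<^sup>\<dagger> (star x) = star (f\<^sup>\<dagger> x)"
proof (rule state_nondegenerate[OF dom.state])
  fix y
  have "\<psi> (y * star (f\<^sup>\<dagger> x)) = cnj (\<psi> (f\<^sup>\<dagger> x * star y))"
    by (simp add: star_mult flip: state_star[OF dom.state])
  also have "\<dots> = \<chi> (f y * star x)"
    by (simp add: f_adj_right f_star star_mult flip: state_star[OF cod.state])
  finally show "\<psi> (y * f\<^sup>\<dagger> (star x)) = \<psi> (y * star (f\<^sup>\<dagger> x))"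
    by (simp add: f_adj_left)
qed

lemma state_f_adj: "\<psi> (f\<^sup>\<dagger> x) = \<chi> x"
  using f_adj_left[of 1 x] by (simp add: f_one)

definition compress :: "('a \<Rightarrow> 'a) \<Rightarrow> 'b \<Rightarrow> 'b"
  where "compress X = f\<^sup>\<dagger> \<circ> X \<circ> f"

definition inflate :: "('b \<Rightarrow> 'b) \<Rightarrow> 'a \<Rightarrow> 'a"
  where "inflate T = (\<lambda>x. f (T (f\<^sup>\<dagger> x)))"

lemma clinear_compress: "clinear X \<Longrightarrow> clinear (compress X)"
  and clinear_inflate: "clinear T \<Longrightarrow> clinear (inflate T)"
  using f_clinear f_adj_clinear by (simp_all add: clinear_iff compress_def inflate_def)

text \<open>Since \<open>f\<^sup>\<dagger>\<close> is linear over the image of \<open>f\<close>, it passes inside the sum for the convolution;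
  transferring the Casimir tensor then trades the remaining \<open>f\<^sup>\<dagger>\<close> on the left leg for \<open>f\<close> on the
  right leg.\<close>

lemma compress_conv_inflate:
  assumes T: "clinear T" and X: "clinear X"
  shows "compress (cod.conv (inflate T) X) = dom.conv T (compress X)"
proof
  fix x
  have "compress (cod.conv (inflate T) X) x = (\<Sum>d\<in>D. T (x * f\<^sup>\<dagger> d) * f\<^sup>\<dagger> (X (star d)))"
    using f_adj_clinear
    by (simp add: compress_def inflate_def cod.conv_def clinear_sum f_adj_module)
  also have "\<dots> = (\<Sum>e\<in>E. T (x * e) * f\<^sup>\<dagger> (X (f (star e))))"
    using T X f_adj_clinear
    by (intro casimir_transfer[OF dom.tracial_expansion_axioms cod.tracial_expansion_axioms,
          where h = "\<lambda>a b. T (x * a) * f\<^sup>\<dagger> (X b)" and G = "f\<^sup>\<dagger>" and H = f])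
      (simp_all add: f_adj_right clinear_iff algebra_linear)
  finally show "compress (cod.conv (inflate T) X) x = dom.conv T (compress X) x"
    by (simp add: dom.conv_def compress_def)
qed

text \<open>This is the adjoint of multiplicativity of \<open>f\<close>, namely
  \<open>(f\<^sup>\<dagger> \<otimes> f\<^sup>\<dagger>) m\<^sup>\<dagger> = m\<^sup>\<dagger> f\<^sup>\<dagger>\<close>, composed with multiplicativity of \<open>f\<close> itself.\<close>

lemma inflate_conv:
  assumes S: "clinear S" and T: "clinear T"
  shows "cod.conv (inflate S) (inflate T) = inflate (dom.conv S T)"
proof
  fix x
  have "cod.conv (inflate S) (inflate T) x = f (\<Sum>d\<in>D. S (f\<^sup>\<dagger> (x * d)) * T (f\<^sup>\<dagger> (star d)))"
    using f_clinear by (simp add: inflate_def cod.conv_def clinear_sum f_mult)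
  also have "(\<Sum>d\<in>D. S (f\<^sup>\<dagger> (x * d)) * T (f\<^sup>\<dagger> (star d))) = (\<Sum>e\<in>E. S e * T (f\<^sup>\<dagger> (f (star e) * x)))"
  proof (rule casimir_transfer[OF dom.tracial_expansion_axioms cod.tracial_expansion_axioms,
        where h = "\<lambda>a b. S a * T (f\<^sup>\<dagger> b)" and G = "\<lambda>d. f\<^sup>\<dagger> (x * d)"
        and H = "\<lambda>y. f y * x"])
    show "\<psi> (f\<^sup>\<dagger> (x * a) * b) = \<chi> (a * (f b * x))" for a b
      using cod.trace[of x "a * f b"] by (simp add: f_adj_right mult.assoc)
  qed (use S T f_adj_clinear in \<open>simp_all add: clinear_iff algebra_linear\<close>)
  also have "\<dots> = (\<Sum>e\<in>E. S e * T (star e * f\<^sup>\<dagger> x))"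
    by (simp add: f_adj_module)
  also have "\<dots> = (\<Sum>e\<in>E. S (f\<^sup>\<dagger> x * e) * T (star e))"
    using S T by (intro dom.casimir_balanced[symmetric, where h = "\<lambda>a b. S a * T b"])
      (simp_all add: clinear_iff algebra_linear)
  finally show "cod.conv (inflate S) (inflate T) x = inflate (dom.conv S T) x"
    by (simp add: inflate_def dom.conv_def)
qed

lemma star_map_inflate: "star_map (inflate T) = inflate (star_map T)"
  by (simp add: fun_eq_iff star_map_def inflate_def f_adj_star f_star)

text \<open>If \<open>R\<close> supports the compression of the projection \<open>P\<close>, it supports the compression of
  everything below \<open>P\<close>: the complement \<open>Q\<close> of \<open>R\<close> inflates to a projection whose product with \<open>P\<close>
  has trace zero, hence vanishes.\<close>

lemma compress_support:
  assumes P: "clinear P" "cod.conv P P = P" "star_map P = P"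
    and R: "clinear R" "dom.conv R R = R" "star_map R = R"
    and supp: "dom.conv R (compress P) = compress P"
    and X: "clinear X"
  shows "dom.conv R (compress (cod.conv P X)) = compress (cod.conv P X)"
proof -
  define Q where Q: "Q = (\<lambda>x. dom.conv_unit x - R x)"
  have Q_lin: "clinear Q"
    using R(1) dom.clinear_conv_unit by (simp add: Q clinear_iff complex_vector.scale_right_diff_distrib)
  have Q_idem: "dom.conv Q Q = Q"
    using R dom.clinear_conv_unit
    by (simp add: Q dom.conv_diff_left dom.conv_diff_right dom.conv_unit_left dom.conv_unit_right)
  have Q_conv: "dom.conv Q T = (\<lambda>x. T x - dom.conv R T x)" if "clinear T" for T
    using that by (simp add: Q dom.conv_diff_left dom.conv_unit_left)
  have Q_real: "star_map Q = Q"
    using R(3) dom.star_map_conv_unit by (simp add: fun_eq_iff star_map_def Q star_diff)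
  have "compress (cod.conv (inflate Q) P) = (\<lambda>x. 0)"
    using P(1) Q_lin by (simp add: compress_conv_inflate Q_conv clinear_compress supp)
  then have "f\<^sup>\<dagger> (cod.conv (inflate Q) P 1) = 0"
    by (metis compress_def comp_apply f_one)
  then have "\<chi> (cod.conv (inflate Q) P 1) = 0"
    using state_f_adj[of "cod.conv (inflate Q) P 1"] clinear_zero[OF dom.state[THEN state_clinear]]
    by simp
  then have orth: "cod.conv (inflate Q) P = (\<lambda>x. 0)"
    using P Q_lin Q_idem Q_real
    by (intro cod.projections_orthogonal) (simp_all add: clinear_inflate inflate_conv star_map_inflate)
  have "dom.conv Q (compress (cod.conv P X)) = compress (cod.conv (cod.conv (inflate Q) P) X)"
    using P(1) X Q_lin
    by (simp add: compress_conv_inflate cod.clinear_conv cod.conv_assoc clinear_inflate)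
  also have "\<dots> = (\<lambda>x. 0)"
    using f_adj_clinear by (simp add: orth cod.conv_zero_left compress_def fun_eq_iff clinear_zero)
  finally show ?thesis
    using P(1) by (simp add: Q_conv clinear_compress cod.clinear_conv fun_eq_iff)
qed

end


section \<open>Graph homomorphisms and quantum relations\<close>

lemma quantum_graph_expansion:
  assumes "quantum_graph \<psi> A" "tracial \<psi>"
  obtains E where "tracial_expansion \<psi> E"
proof -
  obtain S where "finite S" "complex_vector.span S = (UNIV :: 'a set)"
    using assms(1) by (auto simp: quantum_graph_def quantum_set_def)
  then obtain E where "finite E" "\<And>y. (\<Sum>e\<in>E. \<psi> (star e * y) *\<^sub>C e) = y"
    using finite_span_expansion[of \<psi> S] assms(1) by (auto simp: quantum_graph_def quantum_set_def)
  then show ?thesis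
    using assms that by (auto simp: tracial_expansion_def quantum_graph_def quantum_set_def tracial_def)
qed

theorem theorem4p9:
  fixes \<psi>\<^sub>0 :: "'a::cstar_algebra \<Rightarrow> complex" and A\<^sub>0 :: "'a \<Rightarrow> 'a"
    and \<psi>\<^sub>1 :: "'b::cstar_algebra \<Rightarrow> complex" and A\<^sub>1 :: "'b \<Rightarrow> 'b"
    and f :: "'b \<Rightarrow> 'a"
  assumes "quantum_graph \<psi>\<^sub>0 A\<^sub>0" and "real_graph A\<^sub>0" and "tracial \<psi>\<^sub>0"
    and "quantum_graph \<psi>\<^sub>1 A\<^sub>1" and "real_graph A\<^sub>1" and "tracial \<psi>\<^sub>1"
    and "schur_central \<psi>\<^sub>1 A\<^sub>1"
    and "unital_star_hom f"
  shows "graph_homomorphism \<psi>\<^sub>0 A\<^sub>0 \<psi>\<^sub>1 A\<^sub>1 f \<longleftrightarrow> loc_homomorphism \<psi>\<^sub>0 A\<^sub>0 \<psi>\<^sub>1 A\<^sub>1 f"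
proof -
  obtain E where E: "tracial_expansion \<psi>\<^sub>1 E" using quantum_graph_expansion assms(4,6) by blast
  obtain D where D: "tracial_expansion \<psi>\<^sub>0 D" using quantum_graph_expansion assms(1,3) by blast
  interpret tracial_hom \<psi>\<^sub>1 E \<psi>\<^sub>0 D f
    using E D assms(8) by (simp add: tracial_hom_def tracial_hom_axioms_def)
  define P where "P x = complex_of_real (1 / (delta \<psi>\<^sub>0)\<^sup>2) *\<^sub>C A\<^sub>0 x" for x
  define R where "R x = complex_of_real (1 / (delta \<psi>\<^sub>1)\<^sup>2) *\<^sub>C A\<^sub>1 x" for x
  have A: "clinear A\<^sub>0" "clinear A\<^sub>1" "star_map A\<^sub>0 = A\<^sub>0" "star_map A\<^sub>1 = A\<^sub>1"
    using assms by (simp_all add: quantum_graph_def real_graph_def)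
  then have P: "clinear P" "star_map P = P" and R: "clinear R" "star_map R = R"
    by (simp_all add: P_def R_def clinear_iff scaleC_add_right mult.commute fun_eq_iff star_map_def
        star_scaleC)
  have schur0: "schur \<psi>\<^sub>0 A\<^sub>0 T = cod.conv P T" if "clinear T" for T
    using cod.schur_eq_conv[OF A(1) that] by (simp add: P_def[abs_def])
  have schur1: "schur \<psi>\<^sub>1 A\<^sub>1 T = dom.conv R T" if "clinear T" for T
    using dom.schur_eq_conv[OF A(2) that] by (simp add: R_def[abs_def])
  have PA: "cod.conv P A\<^sub>0 = A\<^sub>0" and RA: "dom.conv R A\<^sub>1 = A\<^sub>1"
    using assms(1,4) A schur0 schur1 by (simp_all add: quantum_graph_def)
  \<comment> \<open>The normalising factor is placed in the left argument of the convolution, so that \<open>A \<bullet> A = A\<close>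
    reads \<open>P * A\<^sub>0 = A\<^sub>0\<close>; scaling the right argument as well makes \<open>P\<close> idempotent.\<close>
  have P_idem: "cod.conv P P = P"
    using PA by (simp add: fun_eq_iff cod.conv_def P_def[of "star _"] mult_scaleC_right P_def
        flip: complex_vector.scale_sum_right)
  have R_idem: "dom.conv R R = R"
    using RA by (simp add: fun_eq_iff dom.conv_def R_def[of "star _"] mult_scaleC_right R_def
        flip: complex_vector.scale_sum_right)
  have graph: "graph_homomorphism \<psi>\<^sub>0 A\<^sub>0 \<psi>\<^sub>1 A\<^sub>1 f \<longleftrightarrow> dom.conv R (compress A\<^sub>0) = compress A\<^sub>0"
    using A by (simp add: graph_homomorphism_def schur1 clinear_compress flip: compress_def)
  have loc: "loc_homomorphism \<psi>\<^sub>0 A\<^sub>0 \<psi>\<^sub>1 A\<^sub>1 f \<longleftrightarrow>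
      (\<forall>T. clinear T \<longrightarrow> (\<exists>U. clinear U \<and> compress (cod.conv P T) = dom.conv R U))"
    by (auto simp: loc_homomorphism_def quantum_relation_def schur0 schur1 image_iff subset_iff
        compress_def)
  show ?thesis
  proof
    assume "graph_homomorphism \<psi>\<^sub>0 A\<^sub>0 \<psi>\<^sub>1 A\<^sub>1 f"
    then have supp: "dom.conv R (compress A\<^sub>0) = compress A\<^sub>0" by (simp add: graph)
    have compress_P: "compress P x = complex_of_real (1 / (delta \<psi>\<^sub>0)\<^sup>2) *\<^sub>C compress A\<^sub>0 x" for x
      using f_adj_clinear by (simp add: compress_def P_def clinear_scaleC)
    have "dom.conv R (compress P) = compress P"
      using supp by (simp add: fun_eq_iff compress_P dom.conv_def mult_scaleC_right
          flip: complex_vector.scale_sum_right)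
    then have "dom.conv R (compress (cod.conv P T)) = compress (cod.conv P T)" if "clinear T" for T
      using P R P_idem R_idem that by (intro compress_support)
    then show "loc_homomorphism \<psi>\<^sub>0 A\<^sub>0 \<psi>\<^sub>1 A\<^sub>1 f"
      using P(1) by (metis loc clinear_compress cod.clinear_conv)
  next
    assume "loc_homomorphism \<psi>\<^sub>0 A\<^sub>0 \<psi>\<^sub>1 A\<^sub>1 f"
    then obtain U where "clinear U" "compress A\<^sub>0 = dom.conv R U"
      using A(1) PA unfolding loc by metis
    then show "graph_homomorphism \<psi>\<^sub>0 A\<^sub>0 \<psi>\<^sub>1 A\<^sub>1 f"
      using R R_idem by (simp add: graph flip: dom.conv_assoc)
  qed
qed

end
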